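(* Let $\Sigma$ be an integral $\mathbb Q$-affine polyhedral complex in $\mathbb R^n$, and let $\pi\colon\operatorname{Rat}(\mathbb R^n)\to\operatorname{Rat}(|\Sigma|)$ be the restriction map. Then $\pi$ is surjective, i.e. the restrictions of the coordinate functions $x_1,\dots,x_n$ to $|\Sigma|$ generate the semifield $\operatorname{Rat}(|\Sigma|)$ over $\mathbb T\mathbb Q$. Moreover, the kernel $\operatorname{Ker}(\pi)=\{(F,G)\in\operatorname{Rat}(\mathbb R^n)^2:\pi(F)=\pi(G)\}$ is a finitely generated congruence.
   Context: An integral $\mathbb Q$-affine function on $\mathbb R^n$ is $u\mapsto\langle m,u\rangle+\gamma$ with $m\in\mathbb Z^n$, $\gamma\in\mathbb Q$. An integral $\mathbb Q$-affine polyhedron is a set $\{u: L_i(u)\ge0, i=1,\dots,r\}$ with $L_i$ integral $\mathbb Q$-affine; an integral $\mathbb Q$-affine polyhedral complex is a finite collection of such polyhedra closed under taking faces, any two of which meet in a common face; $|\Sigma|$ is the union. A refinement $\Sigma'$ of $\Sigma$ is such a complex with $|\Sigma'|=|\Sigma|$ and each cell of $\Sigma'$ contained in a cell of $\Sigma$. Two half-lines $\{p+tw\}$, $\{p'+tw'\}$ in $|\Sigma|$ are parallel if $w,w'$ are positive multiples of each other; the slope near infinity of $F$ along $\{p+tw\}$ is $\frac{d}{dt}F(p+tw)$ for $t\gg0$. $\operatorname{Rat}(|\Sigma|)$ is the set consisting of $\infty$ and all functions $F\colon|\Sigma|\to\mathbb R$ which are integral $\mathbb Q$-affine on each cell of some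 integral $\mathbb Q$-affine refinement of $\Sigma$ and have the same slope near infinity along any two parallel half-lines in $|\Sigma|$; it is a semifield with $\oplus=\min$, $\odot=+$. $\mathbb T\mathbb Q=\mathbb Q\cup\{\infty\}$ with $\oplus=\min$, $\odot=+$, embedded as constants. $\operatorname{Rat}(\mathbb R^n)$ is the subsemifield of the semifield of piecewise integral $\mathbb Q$-affine functions on $\mathbb R^n$ (together with $\infty$) generated over $\mathbb T\mathbb Q$ by the coordinate functions $x_1,\dots,x_n$ (i.e. all quotients $p\odot q^{-1}$ of tropical polynomials in $x_1,\dots,x_n$ with coefficients in $\mathbb T\mathbb Q$). A congruence on a semiring $S$ is an equivalence relation $\sim$ such that $a\sim b$, $a'\sim b'$ imply $a+a'\sim b+b'$ and $aa'\sim bb'$. A congruence $\sim$ is finitely generated if there are pairs $F_i\sim G_i$ ($i=1,\dots,r$) such that the smallest congruence containing these pairs equals $\sim$. *)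

theory Defs
  imports "HOL-Analysis.Analysis"
begin

text \<open>Points of R^n are vectors of type real^'n (n = CARD('n)).
  The tropical infinity is represented by None; a finite element by Some f.\<close>

definition iqa :: "int^'n \<Rightarrow> rat \<Rightarrow> real^'n \<Rightarrow> real" where
  "iqa m \<gamma> u = (\<Sum>i\<in>UNIV. of_int (m $ i) * u $ i) + of_rat \<gamma>"

definition iqa_polyhedron :: "(real^'n) set \<Rightarrow> bool" where
  "iqa_polyhedron P \<longleftrightarrow>
     (\<exists>L :: ((int^'n) \<times> rat) set. finite L \<and> P = {u. \<forall>(m,\<gamma>)\<in>L. iqa m \<gamma> u \<ge> 0})"

definition iqa_complex :: "(real^'n) set set \<Rightarrow> bool" where
  "iqa_complex \<Sigma> \<longleftrightarrow> finite \<Sigma>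
     \<and> (\<forall>P\<in>\<Sigma>. iqa_polyhedron P)
     \<and> (\<forall>P\<in>\<Sigma>. \<forall>F. F face_of P \<longrightarrow> F \<in> \<Sigma>)
     \<and> (\<forall>P\<in>\<Sigma>. \<forall>Q\<in>\<Sigma>. (P \<inter> Q) face_of P \<and> (P \<inter> Q) face_of Q)"

definition support :: "(real^'n) set set \<Rightarrow> (real^'n) set" where
  "support \<Sigma> = \<Union>\<Sigma>"

definition refinement :: "(real^'n) set set \<Rightarrow> (real^'n) set set \<Rightarrow> bool" where
  "refinement \<Sigma>' \<Sigma> \<longleftrightarrow> iqa_complex \<Sigma>' \<and> support \<Sigma>' = support \<Sigma>
     \<and> (\<forall>C'\<in>\<Sigma>'. \<exists>C\<in>\<Sigma>. C' \<subseteq> C)"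

definition slope_at_infinity :: "(real^'n \<Rightarrow> real) \<Rightarrow> real^'n \<Rightarrow> real^'n \<Rightarrow> real \<Rightarrow> bool" where
  "slope_at_infinity f p w s \<longleftrightarrow>
     (\<exists>T\<ge>0. \<forall>t>T. ((\<lambda>t. f (p + t *\<^sub>R w)) has_real_derivative s) (at t))"

definition half_line_in :: "real^'n \<Rightarrow> real^'n \<Rightarrow> (real^'n) set \<Rightarrow> bool" where
  "half_line_in p w S \<longleftrightarrow> w \<noteq> 0 \<and> (\<forall>t\<ge>0. p + t *\<^sub>R w \<in> S)"

text \<open>Finite elements of Rat(|Sigma|); only values on |Sigma| matter.\<close>
definition rat_fun_on :: "(real^'n) set set \<Rightarrow> (real^'n \<Rightarrow> real) \<Rightarrow> bool" where
  "rat_fun_on \<Sigma> f \<longleftrightarrow>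
     (\<exists>\<Sigma>'. refinement \<Sigma>' \<Sigma> \<and> (\<forall>C\<in>\<Sigma>'. \<exists>m \<gamma>. \<forall>x\<in>C. f x = iqa m \<gamma> x))
   \<and> (\<forall>p p' w s s'. half_line_in p w (support \<Sigma>) \<longrightarrow> half_line_in p' w (support \<Sigma>)
        \<longrightarrow> slope_at_infinity f p w s \<longrightarrow> slope_at_infinity f p' w s' \<longrightarrow> s = s')"

definition restr :: "(real^'n) set \<Rightarrow> (real^'n \<Rightarrow> real) option \<Rightarrow> (real^'n \<Rightarrow> real) option" where
  "restr S F = map_option (\<lambda>f x. if x \<in> S then f x else 0) F"

definition RatS :: "(real^'n) set set \<Rightarrow> (real^'n \<Rightarrow> real) option set" where
  "RatS \<Sigma> = insert None {Some f | f. (\<forall>x. x \<notin> support \<Sigma> \<longrightarrow> f x = 0) \<and> rat_fun_on \<Sigma> f}"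

definition tpoly :: "(rat \<times> (nat^'n)) set \<Rightarrow> real^'n \<Rightarrow> real" where
  "tpoly T x = Min ((\<lambda>(c,a). of_rat c + (\<Sum>i\<in>UNIV. of_nat (a $ i) * x $ i)) ` T)"

definition RatRn :: "(real^'n \<Rightarrow> real) option set" where
  "RatRn = insert None {Some (\<lambda>x. tpoly P x - tpoly Q x) | P Q.
      finite P \<and> P \<noteq> {} \<and> finite Q \<and> Q \<noteq> {}}"

fun tadd :: "('a \<Rightarrow> real) option \<Rightarrow> ('a \<Rightarrow> real) option \<Rightarrow> ('a \<Rightarrow> real) option" where
  "tadd None G = G"
| "tadd F None = F"
| "tadd (Some f) (Some g) = Some (\<lambda>x. min (f x) (g x))"

fun tmul :: "('a \<Rightarrow> real) option \<Rightarrow> ('a \<Rightarrow> real) option \<Rightarrow> ('a \<Rightarrow> real) option" where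
  "tmul (Some f) (Some g) = Some (\<lambda>x. f x + g x)"
| "tmul _ _ = None"

definition congruence_on :: "'b set \<Rightarrow> ('b \<Rightarrow> 'b \<Rightarrow> 'b) \<Rightarrow> ('b \<Rightarrow> 'b \<Rightarrow> 'b) \<Rightarrow> ('b \<times> 'b) set \<Rightarrow> bool" where
  "congruence_on A add mul R \<longleftrightarrow> R \<subseteq> A \<times> A \<and> equiv A R
     \<and> (\<forall>a b a' b'. (a,b) \<in> R \<longrightarrow> (a',b') \<in> R \<longrightarrow>
          (add a a', add b b') \<in> R \<and> (mul a a', mul b b') \<in> R)"

definition generated_congruence :: "'b set \<Rightarrow> ('b \<Rightarrow> 'b \<Rightarrow> 'b) \<Rightarrow> ('b \<Rightarrow> 'b \<Rightarrow> 'b) \<Rightarrow> ('b \<times> 'b) set \<Rightarrow> ('b \<times> 'b) set" where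
  "generated_congruence A add mul P = \<Inter>{R. congruence_on A add mul R \<and> P \<subseteq> R}"

definition finitely_generated_congruence :: "'b set \<Rightarrow> ('b \<Rightarrow> 'b \<Rightarrow> 'b) \<Rightarrow> ('b \<Rightarrow> 'b \<Rightarrow> 'b) \<Rightarrow> ('b \<times> 'b) set \<Rightarrow> bool" where
  "finitely_generated_congruence A add mul R \<longleftrightarrow>
     (\<exists>P. finite P \<and> P \<subseteq> A \<times> A \<and> R = generated_congruence A add mul P)"

end

theory Submission
  imports Defs
begin

text \<open>
  Everything reduces to one consequence of Farkas' lemma. Let \<open>C\<close> and \<open>D\<close> be polyhedra, and let
  \<open>c\<close> be an affine function that is nonpositive on \<open>C \<inter> D\<close> and does not grow along the common recession
  directions of \<open>C\<close> and \<open>D\<close>. Then \<open>c\<close> is bounded on \<open>C\<close> by a multiple of the penalty of \<open>D\<close>, the sum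
  of the negative parts of the inequalities defining \<open>D\<close>.

  If \<open>f\<close> equals \<open>l\<^sub>C\<close> on each cell \<open>C\<close> of a refinement, apply this to \<open>l\<^sub>C - l\<^sub>D\<close>, which vanishes on
  \<open>C \<inter> D\<close> and, because slopes along parallel half-lines agree, on the common recession directions. So
  \<open>G\<^sub>D = l\<^sub>D + k\<^sub>D \<cdot> penalty D\<close> equals \<open>f\<close> on \<open>D\<close> and dominates \<open>f\<close> on the support, and the minimum of the
  \<open>G\<^sub>D\<close> extends \<open>f\<close>.

  For the kernel, let \<open>h\<close> be the minimum of the penalties of the nonempty cells. A tropical rational
  function \<open>f\<close> that vanishes on the support is affine on the cells of a hyperplane arrangement, so the
  same argument gives \<open>f \<le> k h\<close>, and in a congruence \<open>0 \<sim> h\<close> then forces \<open>0 \<sim> f\<close> for \<open>f \<ge> 0\<close>.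
\<close>

section \<open>Systems of affine inequalities\<close>

text \<open>An affine form is stored as the pair of its gradient and its constant. Forms are then
  vectors of a Euclidean space, so they can be subtracted and combined linearly, and Farkas' lemma
  applies to them directly.\<close>

definition aff :: "'a::real_inner \<times> real \<Rightarrow> 'a \<Rightarrow> real" where
  "aff l u = fst l \<bullet> u + snd l"

definition halfsp :: "('a::real_inner \<times> real) set \<Rightarrow> 'a set" where
  "halfsp L = {u. \<forall>l\<in>L. 0 \<le> aff l u}"

definition penalty :: "('a::real_inner \<times> real) set \<Rightarrow> 'a \<Rightarrow> real" where
  "penalty M u = (\<Sum>l\<in>M. max 0 (- aff l u))"

lemma aff_minus [simp]: "aff (- l) u = - aff l u"
  by (simp add: aff_def)

lemma aff_diff: "aff (l - l') u = aff l u - aff l' u"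
  by (simp add: aff_def inner_diff_left)

lemma aff_sum: "aff (\<Sum>v\<in>S. w v *\<^sub>R v) u = (\<Sum>v\<in>S. w v * aff v u)"
  by (simp add: aff_def fst_sum snd_sum inner_sum_left distrib_left sum.distrib)

lemma aff_convex_comb:
  assumes "a + b = 1"
  shows "aff l (a *\<^sub>R u + b *\<^sub>R v) = a * aff l u + b * aff l v"
proof -
  have "snd l = (a + b) * snd l" using assms by simp
  then show ?thesis by (simp add: aff_def inner_add_right distrib_left distrib_right)
qed

lemma aff_ray: "aff l (p + t *\<^sub>R w) = aff l p + t * (fst l \<bullet> w)"
  by (simp add: aff_def inner_add_right)

lemma halfsp_Un: "halfsp (L \<union> M) = halfsp L \<inter> halfsp M"
  by (auto simp: halfsp_def)

lemma halfsp_ray: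
  assumes "p \<in> halfsp L" "\<And>l. l \<in> L \<Longrightarrow> 0 \<le> fst l \<bullet> w" "0 \<le> t"
  shows "p + t *\<^sub>R w \<in> halfsp L"
  using assms by (auto simp: halfsp_def aff_ray)

lemma convex_halfsp: "convex (halfsp L)"
  by (rule convexI) (auto simp: halfsp_def aff_convex_comb)

lemma penalty_nonneg: "0 \<le> penalty M u"
  by (simp add: penalty_def sum_nonneg)

lemma penalty_eq_0: "u \<in> halfsp M \<Longrightarrow> penalty M u = 0"
  by (auto simp: penalty_def halfsp_def intro!: sum.neutral)

text \<open>A finitely generated cone is closed, so a vector \<open>c\<close> outside it is strictly
  separated from it; the separating normal is nonnegative on \<open>S\<close> but negative on
  \<open>c\<close>.\<close>

lemma farkas:
  fixes S :: "'a::euclidean_space set"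
  assumes fin: "finite S"
    and c: "\<And>x. (\<And>v. v \<in> S \<Longrightarrow> 0 \<le> v \<bullet> x) \<Longrightarrow> 0 \<le> c \<bullet> x"
  shows "\<exists>w. (\<forall>v\<in>S. 0 \<le> w v) \<and> c = (\<Sum>v\<in>S. w v *\<^sub>R v)"
proof -
  let ?H = "convex_cone hull S"
  let ?T = "{(\<Sum>v\<in>S. w v *\<^sub>R v) | w. \<forall>v\<in>S. 0 \<le> w v}"
  have "c \<in> ?H"
  proof (rule ccontr)
    assume "c \<notin> ?H"
    then obtain a b where ab: "a \<bullet> c < b" "\<forall>x\<in>?H. b < a \<bullet> x"
      using separating_hyperplane_closed_point[OF convex_convex_cone_hull closed_convex_cone_hull[OF fin]]
      by blast
    have b: "b < 0"
      using ab(2) convex_cone_hull_contains_0[of S] by fastforce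
    have "0 \<le> v \<bullet> a" if "v \<in> S" for v
    proof (rule ccontr)
      assume neg: "\<not> 0 \<le> v \<bullet> a"
      \<comment> \<open>Both \<open>b\<close> and \<open>v \<bullet> a\<close> are negative, so this
        is a nonnegative multiple of \<open>v\<close>; it is scaled so that \<open>a\<close> takes
        exactly the value \<open>b\<close> there.\<close>
      then have "(b / (v \<bullet> a)) *\<^sub>R v \<in> ?H"
        using b that by (intro convex_cone_hull_mul hull_inc) (auto simp: divide_nonpos_nonpos)
      then have "b < a \<bullet> ((b / (v \<bullet> a)) *\<^sub>R v)"
        using ab(2) by blast
      also have "\<dots> = b"
        using neg by (simp add: inner_commute)
      finally show False by simp
    qed
    then have "0 \<le> c \<bullet> a" by (rule c)
    then show False
      using ab(1) b by (simp add: inner_commute)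
  qed
  also have "?H \<subseteq> ?T"
  proof (rule hull_minimal)
    show "S \<subseteq> ?T"
    proof
      fix v assume "v \<in> S"
      then have "(\<Sum>x\<in>S. (if x = v then 1 else 0) *\<^sub>R x) = v"
        using fin by (simp add: if_distrib[where f="\<lambda>t. t *\<^sub>R _"] cong: if_cong)
      then show "v \<in> ?T"
        by (intro CollectI exI[of _ "\<lambda>x. if x = v then 1 else 0"]) auto
    qed
    show "convex_cone ?T"
      unfolding convex_cone_iff
    proof (intro conjI ballI allI impI)
      show "0 \<in> ?T"
        by (intro CollectI exI[of _ "\<lambda>x. 0"]) auto
    next
      fix x y assume "x \<in> ?T" "y \<in> ?T"
      then obtain w w' where "\<forall>v\<in>S. 0 \<le> w v" "x = (\<Sum>v\<in>S. w v *\<^sub>R v)"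
        "\<forall>v\<in>S. 0 \<le> w' v" "y = (\<Sum>v\<in>S. w' v *\<^sub>R v)" by blast
      then show "x + y \<in> ?T"
        by (intro CollectI exI[of _ "\<lambda>v. w v + w' v"]) (auto simp: scaleR_add_left sum.distrib)
    next
      fix x and d :: real assume "x \<in> ?T" "0 \<le> d"
      then obtain w where "\<forall>v\<in>S. 0 \<le> w v" "x = (\<Sum>v\<in>S. w v *\<^sub>R v)" by blast
      with \<open>0 \<le> d\<close> show "d *\<^sub>R x \<in> ?T"
        by (intro CollectI exI[of _ "\<lambda>v. d * w v"]) (auto simp: scaleR_sum_right)
    qed
  qed
  finally show ?thesis by blast
qed

text \<open>Farkas' lemma is applied to the homogenised inequalities in \<open>(r, t)\<close> with \<open>t \<ge> 0\<close>: points with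
  \<open>t > 0\<close> come from \<open>halfsp L \<inter> halfsp M\<close>, those with \<open>t = 0\<close> are recession directions. The latter
  hypothesis is needed even when the intersection is empty.\<close>
lemma aff_le_penalty:
  fixes c :: "'a::euclidean_space \<times> real"
  assumes fin: "finite L" "finite M"
    and pts: "\<And>u. u \<in> halfsp L \<Longrightarrow> u \<in> halfsp M \<Longrightarrow> aff c u \<le> 0"
    and dirs: "\<And>r. (\<And>l. l \<in> L \<union> M \<Longrightarrow> 0 \<le> fst l \<bullet> r) \<Longrightarrow> fst c \<bullet> r \<le> 0"
  shows "\<exists>k::nat. \<forall>u\<in>halfsp L. aff c u \<le> k * penalty M u"
proof -
  \<comment> \<open>The constant form \<open>(0, 1)\<close> encodes \<open>t \<ge> 0\<close> after
    homogenisation.\<close>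
  let ?S = "insert (0, 1) (L \<union> M)"
  have finS: "finite ?S" using fin by simp
  have "\<exists>w. (\<forall>v\<in>?S. 0 \<le> w v) \<and> - c = (\<Sum>v\<in>?S. w v *\<^sub>R v)"
  proof (rule farkas[OF finS])
    fix x :: "'a \<times> real"
    assume x: "\<And>v. v \<in> ?S \<Longrightarrow> 0 \<le> v \<bullet> x"
    obtain r t where rt: "x = (r, t)" by (cases x)
    have t: "0 \<le> t" using x[of "(0,1)"] rt by simp
    have l: "0 \<le> fst l \<bullet> r + snd l * t" if "l \<in> L \<union> M" for l
      using x[of l] that rt by (auto simp: inner_prod_def)
    show "0 \<le> - c \<bullet> x"
    proof (cases "t = 0")
      case True
      then show ?thesis
        using dirs[of r] l rt by (auto simp: inner_prod_def)
    next
      case False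
      with t have t: "0 < t" by simp
      have a: "aff l (r /\<^sub>R t) = (fst l \<bullet> r + snd l * t) / t" for l :: "'a \<times> real"
        using t by (simp add: aff_def field_simps)
      have "aff c (r /\<^sub>R t) \<le> 0"
        using l t by (intro pts) (auto simp: halfsp_def a)
      then show ?thesis
        using t rt by (simp add: a inner_prod_def divide_le_0_iff)
    qed
  qed
  then obtain w where w: "\<And>v. v \<in> ?S \<Longrightarrow> 0 \<le> w v" and c: "- c = (\<Sum>v\<in>?S. w v *\<^sub>R v)"
    by blast
  \<comment> \<open>The total weight bounds every single weight. Rounding up to a natural number
    matters because natural multiples stay tropical rational.\<close>
  define k where "k = nat \<lceil>\<Sum>v\<in>?S. w v\<rceil>"
  have wk: "w v \<le> k" if "v \<in> ?S" for v
  proof -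
    have "w v \<le> (\<Sum>v\<in>?S. w v)"
      using finS w that by (intro member_le_sum) auto
    then show ?thesis unfolding k_def by linarith
  qed
  show ?thesis
  proof (intro exI ballI)
    fix u assume u: "u \<in> halfsp L"
    have "aff c u = (\<Sum>v\<in>?S. - (w v * aff v u))"
      using arg_cong[OF c, of "\<lambda>l. aff l u"] by (simp add: aff_sum sum_negf del: sum.insert)
    \<comment> \<open>Forms outside \<open>M\<close> are nonnegative on \<open>halfsp L\<close> and
      contribute nothing positive; forms in \<open>M\<close> contribute at most \<open>k\<close>
      times their negative part.\<close>
    also have "\<dots> \<le> (\<Sum>v\<in>?S. if v \<in> M then k * max 0 (- aff v u) else 0)"
    proof (rule sum_mono)
      fix v assume v: "v \<in> ?S"
      show "- (w v * aff v u) \<le> (if v \<in> M then k * max 0 (- aff v u) else 0)"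
      proof (cases "v \<in> M")
        case True
        have "w v * (- aff v u) \<le> w v * max 0 (- aff v u)"
          using w[OF v] by (intro mult_left_mono) auto
        also have "\<dots> \<le> k * max 0 (- aff v u)"
          using wk[OF v] by (intro mult_right_mono) auto
        finally show ?thesis using True by simp
      next
        case False
        then have "0 \<le> aff v u"
          using v u by (auto simp: halfsp_def aff_def)
        then show ?thesis using False w[OF v] by simp
      qed
    qed
    also have "\<dots> = (\<Sum>v\<in>M. k * max 0 (- aff v u))"
      using finS by (intro sum.mono_neutral_cong_right) auto
    finally show "aff c u \<le> k * penalty M u"
      by (simp add: penalty_def sum_distrib_left)
  qed
qed

text \<open>As \<open>h\<close> is nonnegative, the sum of the finitely many individual factors
  serves all indices at once.\<close>

lemma uniform_factor:
  assumes "finite I" and "\<And>u. 0 \<le> h u"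
    and "\<And>i. i \<in> I \<Longrightarrow> \<exists>k::nat. \<forall>u\<in>A i. g i u \<le> k * (h u :: real)"
  shows "\<exists>k::nat. \<forall>i\<in>I. \<forall>u\<in>A i. g i u \<le> k * h u"
proof -
  obtain k where k: "\<And>i. i \<in> I \<Longrightarrow> \<forall>u\<in>A i. g i u \<le> real (k i) * h u"
    using assms(3) by metis
  have "g i u \<le> real (\<Sum>i\<in>I. k i) * h u" if "i \<in> I" "u \<in> A i" for i u
  proof -
    have "g i u \<le> real (k i) * h u" using k that by blast
    also have "k i \<le> (\<Sum>i\<in>I. k i)" using assms(1) that by (intro member_le_sum) auto
    then have "real (k i) * h u \<le> real (\<Sum>i\<in>I. k i) * h u"
      using assms(2) by (intro mult_right_mono of_nat_mono)
    finally show ?thesis .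
  qed
  then show ?thesis by blast
qed

section \<open>Slopes near infinity\<close>

lemma bounded_linear_growth_0:
  fixes a c B T :: real
  assumes "\<And>t. T < t \<Longrightarrow> a * t + c \<le> B" "\<And>t. T < t \<Longrightarrow> - B \<le> a * t + c"
  shows "a = 0"
proof (rule ccontr)
  assume a: "a \<noteq> 0"
  \<comment> \<open>Beyond \<open>T\<close>, and so large that the linear term outgrows both
    \<open>B\<close> and \<open>c\<close>.\<close>
  define t where "t = max (T + 1) ((\<bar>B\<bar> + \<bar>c\<bar> + 1) / \<bar>a\<bar>)"
  have "T < t" by (simp add: t_def)
  have "(\<bar>B\<bar> + \<bar>c\<bar> + 1) / \<bar>a\<bar> \<le> t" by (simp add: t_def)
  then have "\<bar>B\<bar> + \<bar>c\<bar> + 1 \<le> \<bar>a\<bar> * t"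
    using a by (simp add: divide_le_eq mult.commute)
  then show False
    using assms[OF \<open>T < t\<close>] a by (auto simp: abs_if split: if_splits)
qed

text \<open>After subtracting \<open>s * t\<close> the derivative vanishes on the interval
  \<open>{T<..}\<close>, so the difference is constant there.\<close>

lemma slope_at_infinity_affine:
  assumes "slope_at_infinity f p w s"
  shows "\<exists>T\<ge>0. \<exists>c. \<forall>t>T. f (p + t *\<^sub>R w) = s * t + c"
proof -
  obtain T where T: "T \<ge> 0"
    and d: "\<And>t. t > T \<Longrightarrow> ((\<lambda>t. f (p + t *\<^sub>R w)) has_real_derivative s) (at t)"
    using assms unfolding slope_at_infinity_def by blast
  have "\<exists>c. \<forall>t\<in>{T<..}. f (p + t *\<^sub>R w) - s * t = c"
  proof (rule has_field_derivative_zero_constant)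
    fix t assume "t \<in> {T<..}"
    then have "((\<lambda>t. f (p + t *\<^sub>R w) - s * t) has_real_derivative s - s * 1) (at t)"
      by (intro derivative_intros d) auto
    then show "((\<lambda>t. f (p + t *\<^sub>R w) - s * t) has_real_derivative 0) (at t within {T<..})"
      by (simp add: has_field_derivative_at_within)
  qed simp
  then obtain c where "\<forall>t>T. f (p + t *\<^sub>R w) - s * t = c" by auto
  then have "\<forall>t>T. f (p + t *\<^sub>R w) = s * t + c" by (auto simp: algebra_simps)
  then show ?thesis using T by blast
qed

text \<open>Two eventually affine functions at bounded distance have the same slope. Lipschitz
  functions meet the bound, since points with equal parameter on parallel rays keep a constant
  distance.\<close>

lemma slope_at_infinity_eqI:
  assumes "slope_at_infinity f p w s" "slope_at_infinity f p' w s'"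
    and B: "\<And>t. 0 \<le> t \<Longrightarrow> \<bar>f (p + t *\<^sub>R w) - f (p' + t *\<^sub>R w)\<bar> \<le> B"
  shows "s = s'"
proof -
  obtain T c where T: "T \<ge> 0" "\<forall>t>T. f (p + t *\<^sub>R w) = s * t + c"
    using slope_at_infinity_affine[OF assms(1)] by blast
  obtain T' c' where T': "T' \<ge> 0" "\<forall>t>T'. f (p' + t *\<^sub>R w) = s' * t + c'"
    using slope_at_infinity_affine[OF assms(2)] by blast
  have "s - s' = 0"
  proof (rule bounded_linear_growth_0)
    fix t assume "max T T' < t"
    then have "\<bar>(s * t + c) - (s' * t + c')\<bar> \<le> B"
      using B[of t] T T' by auto
    then show "(s - s') * t + (c - c') \<le> B" "- B \<le> (s - s') * t + (c - c')"
      by (simp_all add: algebra_simps abs_le_iff)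
  qed
  then show ?thesis by simp
qed

lemma slope_at_infinity_aff:
  assumes "\<And>t. 0 \<le> t \<Longrightarrow> f (p + t *\<^sub>R w) = aff l (p + t *\<^sub>R w)"
  shows "slope_at_infinity f p w (fst l \<bullet> w)"
  unfolding slope_at_infinity_def
proof (intro exI[of _ 0] conjI allI impI)
  fix t :: real assume t: "0 < t"
  have "((\<lambda>t. aff l p + t * (fst l \<bullet> w)) has_real_derivative fst l \<bullet> w) (at t)"
    by (auto intro!: derivative_eq_intros)
  then show "((\<lambda>t. f (p + t *\<^sub>R w)) has_real_derivative fst l \<bullet> w) (at t)"
    by (rule has_field_derivative_transform_within_open[of _ _ _ "{0<..}"])
       (use t in \<open>auto simp: assms aff_ray[symmetric]\<close>)
qed simp

section \<open>Faces and refinements\<close>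

text \<open>Each form in \<open>J\<close> is nonnegative on the polyhedron, so its zero set is a
  supporting hyperplane and cuts out a face; faces are closed under intersection.\<close>

lemma halfsp_equalities_face_of:
  fixes L :: "('a::euclidean_space \<times> real) set"
  assumes "J \<subseteq> L"
  shows "{u \<in> halfsp L. \<forall>l\<in>J. aff l u = 0} face_of halfsp L"
proof -
  have one: "halfsp L \<inter> {u. aff l u = 0} face_of halfsp L" if "l \<in> J" for l
  proof -
    have "halfsp L \<inter> {u. fst l \<bullet> u = - snd l} face_of halfsp L"
      using that assms
      by (intro face_of_Int_supporting_hyperplane_ge convex_halfsp)
         (fastforce simp: halfsp_def aff_def)
    moreover have "{u. aff l u = 0} = {u. fst l \<bullet> u = - snd l}"
      by (auto simp: aff_def)
    ultimately show ?thesis by simp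
  qed
  \<comment> \<open>Inserting the whole polyhedron keeps the family nonempty when \<open>J\<close>
    is empty.\<close>
  have "\<Inter> (insert (halfsp L) ((\<lambda>l. halfsp L \<inter> {u. aff l u = 0}) ` J)) face_of halfsp L"
    using one by (intro face_of_Inter) (auto simp: face_of_refl convex_halfsp)
  moreover have "\<Inter> (insert (halfsp L) ((\<lambda>l. halfsp L \<inter> {u. aff l u = 0}) ` J))
      = {u \<in> halfsp L. \<forall>l\<in>J. aff l u = 0}"
    by auto
  ultimately show ?thesis by simp
qed

text \<open>\<open>J\<close> consists of the constraints active at a point of \<open>F\<close> where as few as possible are active.\<close>
lemma face_of_halfsp:
  fixes L :: "('a::euclidean_space \<times> real) set"
  assumes fin: "finite L" and F: "F face_of halfsp L" and "F \<noteq> {}"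
  shows "\<exists>J\<subseteq>L. F = {u \<in> halfsp L. \<forall>l\<in>J. aff l u = 0}"
proof -
  define J where "J x = {l \<in> L. aff l x = 0}" for x
  obtain x where x: "x \<in> F" and xmin: "\<And>y. y \<in> F \<Longrightarrow> card (J x) \<le> card (J y)"
    using ex_has_least_nat[of "\<lambda>y. y \<in> F" _ "\<lambda>y. card (J y)"] \<open>F \<noteq> {}\<close> by blast
  have sub: "F \<subseteq> halfsp L" using F face_of_imp_subset by blast
  have finJ: "finite (J y)" for y using fin by (simp add: J_def)
  have "J x \<subseteq> J u" if u: "u \<in> F" for u
  proof -
    \<comment> \<open>A constraint active at the midpoint is active at both ends, since both values
      are nonnegative. Minimality at \<open>x\<close> then forces the active sets of
      \<open>y\<close> and \<open>x\<close> to agree.\<close>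
    define y where "y = (1/2) *\<^sub>R x + (1/2) *\<^sub>R u"
    have "y \<in> F"
      unfolding y_def using face_of_imp_convex[OF F] x u by (intro convexD) auto
    have y: "aff l y = aff l x / 2 + aff l u / 2" for l
      unfolding y_def by (subst aff_convex_comb) auto
    have "0 \<le> aff l x" "0 \<le> aff l u" if "l \<in> L" for l
      using x u sub that by (auto simp: halfsp_def)
    then have "J y \<subseteq> J x \<inter> J u"
      by (force simp: J_def y)
    then have "J y = J x"
      using xmin[OF \<open>y \<in> F\<close>] finJ by (intro card_seteq) auto
    then show ?thesis using \<open>J y \<subseteq> J x \<inter> J u\<close> by blast
  qed
  then have 1: "F \<subseteq> {u \<in> halfsp L. \<forall>l\<in>J x. aff l u = 0}"
    using sub by (auto simp: J_def)
  have "u \<in> F" if u: "u \<in> halfsp L" and Ju: "\<forall>l\<in>J x. aff l u = 0" for u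
  proof (cases "u = x")
    case False
    \<comment> \<open>A step length short enough to keep every constraint inactive at
      \<open>x\<close> nonnegative; the \<open>1\<close> covers the case that there are
      none.\<close>
    define e where "e = Min (insert 1 ((\<lambda>l. aff l x / (1 + \<bar>aff l u\<bar>)) ` (L - J x)))"
    have pos: "0 < aff l x" if "l \<in> L - J x" for l
      using that x sub by (auto simp: J_def halfsp_def less_le)
    have e: "0 < e"
      unfolding e_def using fin pos by (subst Min_gr_iff) (auto intro!: divide_pos_pos add_pos_nonneg)
    \<comment> \<open>Moving from \<open>u\<close> through \<open>x\<close> and slightly beyond puts
      \<open>x\<close> strictly between \<open>u\<close> and \<open>v\<close>, so the face property
      yields \<open>u \<in> F\<close>.\<close>
    define v where "v = (1 + e) *\<^sub>R x + (- e) *\<^sub>R u"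
    have v: "aff l v = (1 + e) * aff l x + (- e) * aff l u" for l
      unfolding v_def by (subst aff_convex_comb) auto
    have "0 \<le> aff l v" if "l \<in> L" for l
    proof (cases "l \<in> J x")
      case True
      then have "aff l u = 0" "aff l x = 0" using Ju by (blast, simp add: J_def)
      then show ?thesis by (simp add: v)
    next
      case False
      then have "e \<le> aff l x / (1 + \<bar>aff l u\<bar>)"
        unfolding e_def using fin that by (intro Min_le) auto
      then have "e * (1 + \<bar>aff l u\<bar>) \<le> aff l x"
        by (subst (asm) pos_le_divide_eq) auto
      moreover have "e * aff l u \<le> e * (1 + \<bar>aff l u\<bar>)" "0 \<le> e * aff l x"
        using e pos[of l] that False by (auto intro!: mult_left_mono mult_nonneg_nonneg)
      ultimately show ?thesis unfolding v distrib_right by linarith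
    qed
    then have "v \<in> halfsp L" by (simp add: halfsp_def)
    moreover have "x \<in> open_segment u v"
    proof -
      have "u \<noteq> v"
      proof
        assume "u = v"
        then have "(1 + e) *\<^sub>R u = (1 + e) *\<^sub>R x" by (simp add: v_def algebra_simps)
        then show False using e False by simp
      qed
      moreover have "x = (1 - 1 / (1 + e)) *\<^sub>R u + (1 / (1 + e)) *\<^sub>R v"
      proof -
        have "(1 / (1 + e)) *\<^sub>R v = x - (e / (1 + e)) *\<^sub>R u"
          using e by (simp add: v_def scaleR_diff_right add_nonneg_eq_0_iff)
        moreover have "1 - 1 / (1 + e) = e / (1 + e)" using e by (simp add: field_simps)
        ultimately show ?thesis by simp
      qed
      ultimately show ?thesis
        using e unfolding in_segment by (intro conjI exI[of _ "1 / (1 + e)"]) auto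
    qed
    ultimately show ?thesis
      using face_ofD[OF F _ u] x by blast
  qed (simp add: x)
  then have "F = {u \<in> halfsp L. \<forall>l\<in>J x. aff l u = 0}" using 1 by blast
  moreover have "J x \<subseteq> L" by (auto simp: J_def)
  ultimately show ?thesis by blast
qed


section \<open>Integral affine forms and hyperplane arrangements\<close>

definition iqv :: "int^'n \<Rightarrow> rat \<Rightarrow> (real^'n) \<times> real" where
  "iqv m \<gamma> = ((\<chi> i. of_int (m $ i)), of_rat \<gamma>)"

definition iqaff :: "((real^'n) \<times> real) set" where
  "iqaff = {iqv m \<gamma> | m \<gamma>. True}"

lemma iqa_eq_aff: "iqa m \<gamma> u = aff (iqv m \<gamma>) u"
  by (simp add: iqa_def aff_def iqv_def inner_vec_def)

lemma iqv_in_iqaff [simp]: "iqv m \<gamma> \<in> iqaff"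
  by (auto simp: iqaff_def)

lemma iqaff_diff:
  assumes "l \<in> iqaff" "l' \<in> iqaff"
  shows "l - l' \<in> iqaff"
proof -
  obtain m \<gamma> m' \<gamma>' where "l = iqv m \<gamma>" "l' = iqv m' \<gamma>'"
    using assms by (auto simp: iqaff_def)
  then have "l - l' = iqv (m - m') (\<gamma> - \<gamma>')"
    by (simp add: iqv_def vec_eq_iff of_rat_diff)
  then show ?thesis by simp
qed

lemma iqa_polyhedron_iff:
  fixes P :: "(real^'n) set"
  shows "iqa_polyhedron P \<longleftrightarrow> (\<exists>L. finite L \<and> L \<subseteq> iqaff \<and> P = halfsp L)"
proof
  assume "iqa_polyhedron P"
  then obtain L :: "((int^'n) \<times> rat) set" where L: "finite L"
    and P: "P = {u. \<forall>(m,\<gamma>)\<in>L. iqa m \<gamma> u \<ge> 0}"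
    by (auto simp: iqa_polyhedron_def)
  show "\<exists>L. finite L \<and> L \<subseteq> iqaff \<and> P = halfsp L"
    by (rule exI[of _ "(\<lambda>(m,\<gamma>). iqv m \<gamma>) ` L"])
       (use L in \<open>auto simp: P halfsp_def iqa_eq_aff\<close>)
next
  assume "\<exists>L. finite L \<and> L \<subseteq> iqaff \<and> P = halfsp L"
  then obtain L where L: "finite L" "L \<subseteq> iqaff" and P: "P = halfsp L" by blast
  have "L \<subseteq> range (\<lambda>(m,\<gamma>). iqv m \<gamma>)" using L(2) by (force simp: iqaff_def)
  then obtain L' where "finite L'" "L = (\<lambda>(m,\<gamma>). iqv m \<gamma>) ` L'"
    using L(1) finite_subset_image by metis
  then show "iqa_polyhedron P"
    unfolding iqa_polyhedron_def P
    by (intro exI[of _ L']) (auto simp: halfsp_def iqa_eq_aff)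
qed

text \<open>For \<open>H\<close> closed under negation, the sets \<open>halfsp K\<close> with \<open>K\<close> in \<open>arrangement H\<close> are the closed
  cells of the hyperplane arrangement of \<open>H\<close>: a hyperplane \<open>h = 0\<close> containing the cell is encoded by
  having both \<open>h\<close> and \<open>- h\<close> in \<open>K\<close>.\<close>
definition arrangement :: "('a::real_inner \<times> real) set \<Rightarrow> ('a \<times> real) set set" where
  "arrangement H = {K. K \<subseteq> H \<and> (\<forall>h\<in>H. h \<in> K \<or> - h \<in> K)}"

lemma finite_arrangement: "finite H \<Longrightarrow> finite (arrangement H)"
  by (rule finite_subset[of _ "Pow H"]) (auto simp: arrangement_def)

lemma arrangement_cover:
  assumes "uminus ` H \<subseteq> H"
  shows "\<exists>K\<in>arrangement H. u \<in> halfsp K"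
proof
  show "{h \<in> H. 0 \<le> aff h u} \<in> arrangement H"
    using assms by (auto simp: arrangement_def)
qed (auto simp: halfsp_def)

lemma arrangement_Un:
  assumes "K \<in> arrangement H" "K' \<subseteq> H"
  shows "K \<union> K' \<in> arrangement H"
  using assms by (auto simp: arrangement_def)

text \<open>A nonempty face of \<open>P \<inter> halfsp K\<close> turns some constraints into
  equalities. Those from \<open>P\<close> cut out a face of \<open>P\<close>, which lies in
  \<Sigma>; those from \<open>K\<close> are imposed by adding negated forms, which stays within the
  arrangement.\<close>

lemma refinement_arrangement:
  fixes \<Sigma> :: "(real^'n) set set"
  assumes \<Sigma>: "iqa_complex \<Sigma>" and H: "finite H" "H \<subseteq> iqaff" "uminus ` H \<subseteq> H"
  shows "refinement {P \<inter> halfsp K | P K. P \<in> \<Sigma> \<and> K \<in> arrangement H} \<Sigma>" (is "refinement ?S' _")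
proof -
  have S: "finite \<Sigma>" "\<And>P. P \<in> \<Sigma> \<Longrightarrow> iqa_polyhedron P"
    "\<And>P F. P \<in> \<Sigma> \<Longrightarrow> F face_of P \<Longrightarrow> F \<in> \<Sigma>"
    "\<And>P Q. P \<in> \<Sigma> \<Longrightarrow> Q \<in> \<Sigma> \<Longrightarrow> (P \<inter> Q) face_of P"
    using \<Sigma> by (auto simp: iqa_complex_def)
  have arr: "finite K" "K \<subseteq> iqaff" "K \<subseteq> H" if "K \<in> arrangement H" for K
    using that H finite_subset by (auto simp: arrangement_def)
  have arr_face: "halfsp K \<inter> halfsp K' face_of halfsp K"
    if K: "K \<in> arrangement H" "K' \<in> arrangement H" for K K'
  proof -
    \<comment> \<open>A form of \<open>K'\<close> missing from \<open>K\<close> has its negative in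
      \<open>K\<close>, so it must vanish on the intersection.\<close>
    have "halfsp K \<inter> halfsp K' = {u \<in> halfsp K. \<forall>l\<in>uminus ` (K' - K) \<inter> K. aff l u = 0}"
    proof (intro equalityI subsetI)
      fix u assume u: "u \<in> halfsp K \<inter> halfsp K'"
      have "aff l u = 0" if l: "l \<in> uminus ` (K' - K) \<inter> K" for l
      proof -
        obtain k where k: "k \<in> K'" "l = - k" using l by blast
        have "0 \<le> aff l u" "0 \<le> aff k u" using l k(1) u unfolding halfsp_def by blast+
        then show ?thesis using k(2) by simp
      qed
      then show "u \<in> {u \<in> halfsp K. \<forall>l\<in>uminus ` (K' - K) \<inter> K. aff l u = 0}"
        using u by blast
    next
      fix u assume u: "u \<in> {u \<in> halfsp K. \<forall>l\<in>uminus ` (K' - K) \<inter> K. aff l u = 0}"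
      have "0 \<le> aff l u" if "l \<in> K'" for l
      proof (cases "l \<in> K")
        case True
        then show ?thesis using u by (auto simp: halfsp_def)
      next
        case False
        then have "- l \<in> K" using K that by (auto simp: arrangement_def)
        then have "aff (- l) u = 0" using u that False by blast
        then show ?thesis by simp
      qed
      then show "u \<in> halfsp K \<inter> halfsp K'" using u by (simp add: halfsp_def)
    qed
    then show ?thesis by (simp add: halfsp_equalities_face_of)
  qed
  have "iqa_complex ?S'"
    unfolding iqa_complex_def
  proof (intro conjI ballI allI impI)
    have "?S' = (\<lambda>(P, K). P \<inter> halfsp K) ` (\<Sigma> \<times> arrangement H)" by auto
    then show "finite ?S'" using S(1) finite_arrangement[OF H(1)] by simp
  next
    fix Q assume "Q \<in> ?S'"
    then obtain P K where Q: "Q = P \<inter> halfsp K" "P \<in> \<Sigma>" "K \<in> arrangement H" by blast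
    then obtain L where "finite L" "L \<subseteq> iqaff" "P = halfsp L"
      using S(2) by (auto simp: iqa_polyhedron_iff)
    then show "iqa_polyhedron Q"
      unfolding iqa_polyhedron_iff using arr[OF Q(3)] Q(1)
      by (intro exI[of _ "L \<union> K"]) (auto simp: halfsp_Un)
  next
    fix Q F assume "Q \<in> ?S'" and F: "F face_of Q"
    then obtain P K where Q: "Q = P \<inter> halfsp K" "P \<in> \<Sigma>" and K: "K \<in> arrangement H" by blast
    then obtain L where L: "finite L" "L \<subseteq> iqaff" "P = halfsp L"
      using S(2) by (auto simp: iqa_polyhedron_iff)
    show "F \<in> ?S'"
    proof (cases "F = {}")
      case True
      have "{} \<in> \<Sigma>" using S(3)[OF Q(2)] by simp
      then show ?thesis using True K by blast
    next
      case False
      have "F face_of halfsp (L \<union> K)" using F Q L by (simp add: halfsp_Un)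
      then obtain J where J: "J \<subseteq> L \<union> K" "F = {u \<in> halfsp (L \<union> K). \<forall>l\<in>J. aff l u = 0}"
        using face_of_halfsp[of "L \<union> K" F] L(1) arr(1)[OF K] False by blast
      have "{u \<in> halfsp L. \<forall>l\<in>J \<inter> L. aff l u = 0} \<in> \<Sigma>"
        using S(3)[OF Q(2)] halfsp_equalities_face_of[of "J \<inter> L" L] L(3) by simp
      moreover have "K \<union> uminus ` (J \<inter> K) \<in> arrangement H"
        using K H(3) arr(3)[OF K] by (intro arrangement_Un) auto
      moreover have "F = {u \<in> halfsp L. \<forall>l\<in>J \<inter> L. aff l u = 0} \<inter> halfsp (K \<union> uminus ` (J \<inter> K))"
      proof -
        have "u \<in> halfsp (uminus ` (J \<inter> K)) \<longleftrightarrow> (\<forall>l\<in>J \<inter> K. aff l u = 0)" if "u \<in> halfsp K" for u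
          using that by (auto simp: halfsp_def intro: antisym)
        then show ?thesis
          unfolding J(2) halfsp_Un using J(1) by blast
      qed
      ultimately show ?thesis by blast
    qed
  next
    fix Q Q' assume "Q \<in> ?S'" "Q' \<in> ?S'"
    then obtain P K P' K' where Q: "Q = P \<inter> halfsp K" "P \<in> \<Sigma>" "K \<in> arrangement H"
      "Q' = P' \<inter> halfsp K'" "P' \<in> \<Sigma>" "K' \<in> arrangement H" by blast
    have "(P \<inter> P') \<inter> (halfsp K \<inter> halfsp K') face_of P \<inter> halfsp K"
      by (rule face_of_Int_Int[OF S(4)[OF Q(2,5)] arr_face[OF Q(3,6)]])
    then show "Q \<inter> Q' face_of Q" by (simp add: Q Int_ac)
    have "(P' \<inter> P) \<inter> (halfsp K' \<inter> halfsp K) face_of P' \<inter> halfsp K'"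
      by (rule face_of_Int_Int[OF S(4)[OF Q(5,2)] arr_face[OF Q(6,3)]])
    then show "Q \<inter> Q' face_of Q'" by (simp add: Q Int_ac)
  qed
  moreover have "support ?S' = support \<Sigma>"
  proof (intro equalityI subsetI)
    fix u assume "u \<in> support \<Sigma>"
    then obtain P where P: "P \<in> \<Sigma>" "u \<in> P" by (auto simp: support_def)
    obtain K where K: "K \<in> arrangement H" "u \<in> halfsp K"
      using arrangement_cover[OF H(3)] by blast
    have "P \<inter> halfsp K \<in> ?S'" using P K by blast
    then show "u \<in> support ?S'" using P K by (auto simp only: support_def)
  qed (auto simp: support_def)
  moreover have "\<exists>P\<in>\<Sigma>. Q \<subseteq> P" if "Q \<in> ?S'" for Q
    using that by auto
  ultimately show ?thesis
    unfolding refinement_def by simp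
qed

section \<open>Tropical rational functions\<close>

fun tmono :: "rat \<times> (nat^'n) \<Rightarrow> (real^'n) \<times> real" where
  "tmono (c, a) = iqv (\<chi> i. int (a $ i)) c"

lemma tmono_in_iqaff [simp]: "tmono t \<in> iqaff"
  by (cases t) simp

declare tmono.simps [simp del]

lemma aff_tmono: "aff (tmono (c, a)) x = of_rat c + (\<Sum>i\<in>UNIV. of_nat (a $ i) * x $ i)"
  by (simp add: tmono.simps iqv_def aff_def inner_vec_def)

lemma tpoly_eq_Min: "tpoly T x = (MIN t\<in>T. aff (tmono t) x)"
proof -
  have "(\<lambda>(c,a). of_rat c + (\<Sum>i\<in>UNIV. of_nat (a $ i) * x $ i)) ` T = (\<lambda>t. aff (tmono t) x) ` T"
    by (intro image_cong) (auto simp: aff_tmono)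
  then show ?thesis by (simp add: tpoly_def)
qed

lemma tpoly_le: "finite T \<Longrightarrow> t \<in> T \<Longrightarrow> tpoly T x \<le> aff (tmono t) x"
  by (simp add: tpoly_eq_Min)

lemma tpoly_attained:
  assumes "finite T" "T \<noteq> {}"
  shows "\<exists>t\<in>T. tpoly T x = aff (tmono t) x"
proof -
  have "tpoly T x \<in> (\<lambda>t. aff (tmono t) x) ` T"
    unfolding tpoly_eq_Min using assms by (intro Min_in) auto
  then show ?thesis by blast
qed

lemma tpoly_eqI:
  assumes "finite T" "s \<in> T" "v = aff (tmono s) x" "\<And>t. t \<in> T \<Longrightarrow> v \<le> aff (tmono t) x"
  shows "tpoly T x = v"
  unfolding tpoly_eq_Min using assms by (intro Min_eqI) auto

lemma tpoly_Un:
  assumes "finite P" "P \<noteq> {}" "finite Q" "Q \<noteq> {}"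
  shows "tpoly (P \<union> Q) x = min (tpoly P x) (tpoly Q x)"
  unfolding tpoly_eq_Min image_Un using assms by (intro Min_Un) auto

text \<open>Tropical monomials multiply by adding coefficients and exponents, which is addition in
  the product type.\<close>

definition tpoly_times :: "(rat \<times> (nat^'n)) set \<Rightarrow> (rat \<times> (nat^'n)) set \<Rightarrow> (rat \<times> (nat^'n)) set" where
  "tpoly_times P Q = (\<lambda>(s, t). s + t) ` (P \<times> Q)"

lemma aff_tmono_add: "aff (tmono (s + t)) x = aff (tmono s) x + aff (tmono t) x"
  by (cases s; cases t)
     (simp add: aff_tmono of_rat_add distrib_right sum.distrib)

lemma tpoly_times_finite_ne:
  assumes "finite P" "P \<noteq> {}" "finite Q" "Q \<noteq> {}"
  shows "finite (tpoly_times P Q)" "tpoly_times P Q \<noteq> {}"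
  using assms by (auto simp: tpoly_times_def)

lemma tpoly_times:
  assumes "finite P" "P \<noteq> {}" "finite Q" "Q \<noteq> {}"
  shows "tpoly (tpoly_times P Q) x = tpoly P x + tpoly Q x"
proof -
  obtain s t where st: "s \<in> P" "t \<in> Q" "tpoly P x = aff (tmono s) x" "tpoly Q x = aff (tmono t) x"
    using tpoly_attained assms by metis
  show ?thesis
  proof (rule tpoly_eqI)
    show "s + t \<in> tpoly_times P Q" using st by (force simp: tpoly_times_def)
    show "tpoly P x + tpoly Q x = aff (tmono (s + t)) x" by (simp add: st aff_tmono_add)
  next
    fix r assume "r \<in> tpoly_times P Q"
    then obtain s' t' where "s' \<in> P" "t' \<in> Q" "r = s' + t'" unfolding tpoly_times_def by auto
    then show "tpoly P x + tpoly Q x \<le> aff (tmono r) x"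
      using assms by (simp add: aff_tmono_add add_mono tpoly_le)
  qed (simp add: tpoly_times_finite_ne assms)
qed

text \<open>The finite elements of \<open>RatRn\<close> as plain functions, so that closure
  properties can be proved without \<open>option\<close>.\<close>

definition trat :: "(real^'n \<Rightarrow> real) set" where
  "trat = {\<lambda>x. tpoly P x - tpoly Q x | P Q. finite P \<and> P \<noteq> {} \<and> finite Q \<and> Q \<noteq> {}}"

lemma RatRn_eq: "RatRn = insert None (Some ` trat)"
  by (auto simp: RatRn_def trat_def)

lemma trat_iff:
  "f \<in> trat \<longleftrightarrow> (\<exists>P Q. finite P \<and> P \<noteq> {} \<and> finite Q \<and> Q \<noteq> {}
    \<and> (\<forall>x. f x = tpoly P x - tpoly Q x))"
  unfolding trat_def by (auto simp: fun_eq_iff)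

lemma tratI:
  assumes "finite P" "P \<noteq> {}" "finite Q" "Q \<noteq> {}" "\<And>x. f x = tpoly P x - tpoly Q x"
  shows "f \<in> trat"
  using assms unfolding trat_iff by blast

text \<open>Exponents in \<open>tpoly\<close> are natural numbers, so the positive and negative
  parts of an integral gradient go into numerator and denominator.\<close>

lemma trat_aff:
  assumes "l \<in> iqaff"
  shows "aff l \<in> trat"
proof -
  obtain m \<gamma> where l: "l = iqv m \<gamma>" using assms by (auto simp: iqaff_def)
  have "(\<Sum>i\<in>UNIV. of_int (m $ i) * x $ i)
      = (\<Sum>i\<in>UNIV. of_nat (nat (m $ i)) * x $ i) - (\<Sum>i\<in>UNIV. of_nat (nat (- m $ i)) * x $ i)"
    for x :: "real^'a"
    unfolding sum_subtractf[symmetric] left_diff_distrib[symmetric]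
    by (intro sum.cong refl arg_cong2[where f="(*)"]) auto
  then show ?thesis
    by (intro tratI[of "{(\<gamma>, \<chi> i. nat (m $ i))}" "{(0, \<chi> i. nat (- m $ i))}"])
       (auto simp: l iqa_eq_aff[symmetric] iqa_def tpoly_def)
qed

lemma trat_const: "(\<lambda>x::real^'n. of_rat c) \<in> trat"
proof -
  have "aff (iqv 0 c) = (\<lambda>x::real^'n. of_rat c)"
    by (auto simp: iqa_eq_aff[symmetric] iqa_def)
  then show ?thesis by (metis trat_aff iqv_in_iqaff)
qed

lemma trat_0: "(\<lambda>x. 0) \<in> trat"
  using trat_const[of 0] by simp

lemma trat_uminus: "f \<in> trat \<Longrightarrow> (\<lambda>x. - f x) \<in> trat"
  unfolding trat_iff by (metis minus_diff_eq)

lemma trat_add: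
  assumes "f \<in> trat" "g \<in> trat"
  shows "(\<lambda>x. f x + g x) \<in> trat"
proof -
  obtain P Q where f: "finite P" "P \<noteq> {}" "finite Q" "Q \<noteq> {}" "\<And>x. f x = tpoly P x - tpoly Q x"
    using assms(1) unfolding trat_iff by blast
  obtain P' Q' where g: "finite P'" "P' \<noteq> {}" "finite Q'" "Q' \<noteq> {}" "\<And>x. g x = tpoly P' x - tpoly Q' x"
    using assms(2) unfolding trat_iff by blast
  show ?thesis
    using f g by (intro tratI[of "tpoly_times P P'" "tpoly_times Q Q'"])
      (simp_all add: tpoly_times tpoly_times_finite_ne)
qed

text \<open>Common denominators:
  \<open>min (p - q) (p' - q') = min (p + q') (p' + q) - (q + q')\<close>.\<close>

lemma trat_min:
  assumes "f \<in> trat" "g \<in> trat"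
  shows "(\<lambda>x. min (f x) (g x)) \<in> trat"
proof -
  obtain P Q where f: "finite P" "P \<noteq> {}" "finite Q" "Q \<noteq> {}" "\<And>x. f x = tpoly P x - tpoly Q x"
    using assms(1) unfolding trat_iff by blast
  obtain P' Q' where g: "finite P'" "P' \<noteq> {}" "finite Q'" "Q' \<noteq> {}" "\<And>x. g x = tpoly P' x - tpoly Q' x"
    using assms(2) unfolding trat_iff by blast
  show ?thesis
    using f g by (intro tratI[of "tpoly_times P Q' \<union> tpoly_times P' Q" "tpoly_times Q Q'"])
      (simp_all add: tpoly_times tpoly_Un tpoly_times_finite_ne min_def)
qed

lemma trat_diff: "f \<in> trat \<Longrightarrow> g \<in> trat \<Longrightarrow> (\<lambda>x. f x - g x) \<in> trat"
  using trat_add[OF _ trat_uminus] by fastforce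

lemma trat_max:
  assumes "f \<in> trat" "g \<in> trat"
  shows "(\<lambda>x. max (f x) (g x)) \<in> trat"
  using trat_uminus[OF trat_min[OF trat_uminus[OF assms(1)] trat_uminus[OF assms(2)]]]
  by (simp add: minus_min_eq_max)

lemma trat_sum: "(\<And>i. i \<in> I \<Longrightarrow> f i \<in> trat) \<Longrightarrow> (\<lambda>x. \<Sum>i\<in>I. f i x) \<in> trat"
  by (induction I rule: infinite_finite_induct) (auto intro: trat_0 trat_add)

text \<open>This is the tropical \<open>k\<close>-th power, and the reason why all penalty factors
  are natural numbers.\<close>

lemma trat_of_nat_mult:
  assumes "f \<in> trat"
  shows "(\<lambda>x. of_nat k * f x) \<in> trat"
  using trat_sum[of "{..<k}" "\<lambda>_. f"] assms by simp

lemma trat_Min: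
  assumes "finite I" "I \<noteq> {}" "\<And>i. i \<in> I \<Longrightarrow> f i \<in> trat"
  shows "(\<lambda>x. MIN i\<in>I. f i x) \<in> trat"
  using assms
proof (induction I rule: finite_ne_induct)
  case (insert i I)
  have "(\<lambda>x. MIN i\<in>insert i I. f i x) = (\<lambda>x. min (f i x) (MIN i\<in>I. f i x))"
    using insert.hyps by auto
  then show ?case using insert by (simp add: trat_min)
qed simp

lemma trat_penalty:
  assumes "M \<subseteq> iqaff"
  shows "penalty M \<in> trat"
proof -
  have "(\<lambda>x. \<Sum>l\<in>M. max 0 (- aff l x)) \<in> trat"
    using assms by (intro trat_sum trat_max trat_0 trat_uminus trat_aff) auto
  then show ?thesis by (simp add: penalty_def[abs_def])
qed

section \<open>Lipschitz bounds and affine pieces\<close>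

lemma tpoly_lipschitz:
  assumes "finite T" "T \<noteq> {}"
  shows "\<exists>B\<ge>0. \<forall>x y. tpoly T x - tpoly T y \<le> B * norm (x - y)"
proof (intro exI[of _ "\<Sum>t\<in>T. norm (fst (tmono t))"] conjI allI)
  fix x y
  \<comment> \<open>The monomial that is minimal at \<open>y\<close> bounds \<open>tpoly T x\<close>
    from above, so the difference is at most that of one affine form.\<close>
  obtain t where t: "t \<in> T" "tpoly T y = aff (tmono t) y"
    using tpoly_attained[OF assms] by blast
  have "tpoly T x - tpoly T y \<le> aff (tmono t) x - aff (tmono t) y"
    using tpoly_le[OF assms(1) t(1)] t(2) by simp
  also have "\<dots> = fst (tmono t) \<bullet> (x - y)"
    by (simp add: aff_def inner_diff_right)
  also have "\<dots> \<le> norm (fst (tmono t)) * norm (x - y)"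
    by (rule norm_cauchy_schwarz)
  also have "\<dots> \<le> (\<Sum>t\<in>T. norm (fst (tmono t))) * norm (x - y)"
    using assms(1) t(1) by (intro mult_right_mono member_le_sum) auto
  finally show "tpoly T x - tpoly T y \<le> (\<Sum>t\<in>T. norm (fst (tmono t))) * norm (x - y)" .
qed (simp add: sum_nonneg)

lemma trat_lipschitz:
  assumes "f \<in> trat"
  shows "\<exists>B\<ge>0. \<forall>x y. \<bar>f x - f y\<bar> \<le> B * norm (x - y)"
proof -
  obtain P Q where f: "finite P" "P \<noteq> {}" "finite Q" "Q \<noteq> {}" "\<And>x. f x = tpoly P x - tpoly Q x"
    using assms unfolding trat_iff by blast
  obtain B where B: "B \<ge> 0" "\<And>x y. tpoly P x - tpoly P y \<le> B * norm (x - y)"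
    using tpoly_lipschitz f by blast
  obtain C where C: "C \<ge> 0" "\<And>x y. tpoly Q x - tpoly Q y \<le> C * norm (x - y)"
    using tpoly_lipschitz f by blast
  have "\<bar>f x - f y\<bar> \<le> (B + C) * norm (x - y)" for x y
    using B(2)[of x y] B(2)[of y x] C(2)[of x y] C(2)[of y x]
    by (simp add: f distrib_right norm_minus_commute abs_le_iff)
  then show ?thesis using B(1) C(1) by (intro exI[of _ "B + C"]) auto
qed

lemma total_preorder_least:
  assumes "finite P" "P \<noteq> {}"
    and "\<And>s t. s \<in> P \<Longrightarrow> t \<in> P \<Longrightarrow> (\<forall>u\<in>A. f s u \<le> f t u) \<or> (\<forall>u\<in>A. f t u \<le> (f s u :: real))"
  shows "\<exists>s\<in>P. \<forall>t\<in>P. \<forall>u\<in>A. f s u \<le> f t u"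
  using assms
proof (induction P rule: finite_ne_induct)
  case (insert a P)
  then obtain s where s: "s \<in> P" "\<forall>t\<in>P. \<forall>u\<in>A. f s u \<le> f t u" by auto
  have "(\<forall>u\<in>A. f a u \<le> f s u) \<or> (\<forall>u\<in>A. f s u \<le> f a u)"
    using insert.prems[of a s] s(1) by blast
  then show ?case
  proof
    assume "\<forall>u\<in>A. f a u \<le> f s u"
    then show ?thesis using s by (intro bexI[of _ a]) (auto intro: order_trans)
  next
    assume "\<forall>u\<in>A. f s u \<le> f a u"
    then show ?thesis using s by (intro bexI[of _ s]) auto
  qed
qed simp

text \<open>For any two monomials \<open>K\<close> contains their difference in one of the two
  orders, so the monomials are totally ordered on the whole cell and the least one is the affine
  piece.\<close>

lemma tpoly_affine_on_cells:
  fixes P :: "(rat \<times> (nat^'n)) set"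
  assumes P: "finite P" "P \<noteq> {}"
    and H: "\<And>s t. s \<in> P \<Longrightarrow> t \<in> P \<Longrightarrow> tmono s - tmono t \<in> H"
    and K: "K \<in> arrangement H"
  shows "\<exists>l\<in>iqaff. \<forall>u\<in>halfsp K. tpoly P u = aff l u"
proof -
  have "\<exists>s\<in>P. \<forall>t\<in>P. \<forall>u\<in>halfsp K. aff (tmono s) u \<le> aff (tmono t) u"
  proof (rule total_preorder_least[OF P])
    fix s t assume "s \<in> P" "t \<in> P"
    then have "tmono s - tmono t \<in> K \<or> tmono t - tmono s \<in> K"
      using H[of s t] K unfolding arrangement_def by fastforce
    then show "(\<forall>u\<in>halfsp K. aff (tmono s) u \<le> aff (tmono t) u)
        \<or> (\<forall>u\<in>halfsp K. aff (tmono t) u \<le> aff (tmono s) u)"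
      by (fastforce simp: halfsp_def aff_diff)
  qed
  then obtain s where "s \<in> P" "\<And>t u. t \<in> P \<Longrightarrow> u \<in> halfsp K \<Longrightarrow> aff (tmono s) u \<le> aff (tmono t) u"
    by blast
  then show ?thesis
    using P by (intro bexI[of _ "tmono s"] ballI tpoly_eqI) auto
qed

lemma trat_affine_on_cells:
  assumes "f \<in> trat"
  shows "\<exists>H. finite H \<and> H \<subseteq> iqaff \<and> uminus ` H \<subseteq> H
    \<and> (\<forall>K\<in>arrangement H. \<exists>l\<in>iqaff. \<forall>u\<in>halfsp K. f u = aff l u)"
proof -
  obtain P Q where f: "finite P" "P \<noteq> {}" "finite Q" "Q \<noteq> {}" "\<And>x. f x = tpoly P x - tpoly Q x"
    using assms unfolding trat_iff by blast
  \<comment> \<open>Differences are taken in both orders, which makes the set closed under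
    negation.\<close>
  define D where "D T = (\<lambda>(s, t). tmono s - tmono t) ` (T \<times> T)" for T :: "(rat \<times> (nat^'a)) set"
  have D: "tmono s - tmono t \<in> D T" if "s \<in> T" "t \<in> T" for s t T
    using that by (force simp: D_def)
  have "uminus ` D T \<subseteq> D T" for T
  proof
    fix h assume "h \<in> uminus ` D T"
    then obtain s t where "s \<in> T" "t \<in> T" "h = tmono t - tmono s" by (auto simp: D_def)
    then show "h \<in> D T" using D by blast
  qed
  then have 1: "uminus ` (D P \<union> D Q) \<subseteq> D P \<union> D Q" by blast
  have 2: "finite (D P \<union> D Q)" "D P \<union> D Q \<subseteq> iqaff"
    using f by (auto simp: D_def intro!: iqaff_diff)
  have "\<exists>l\<in>iqaff. \<forall>u\<in>halfsp K. f u = aff l u" if K: "K \<in> arrangement (D P \<union> D Q)" for K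
  proof -
    obtain l where l: "l \<in> iqaff" "\<forall>u\<in>halfsp K. tpoly P u = aff l u"
      using tpoly_affine_on_cells[OF f(1,2) _ K] D by blast
    obtain l' where l': "l' \<in> iqaff" "\<forall>u\<in>halfsp K. tpoly Q u = aff l' u"
      using tpoly_affine_on_cells[OF f(3,4) _ K] D by blast
    show ?thesis
      using l l' by (intro bexI[of _ "l - l'"] iqaff_diff) (auto simp: f(5) aff_diff)
  qed
  then show ?thesis using 1 2 by blast
qed

section \<open>Restriction to the support and extension from it\<close>

lemma rat_fun_on_trat:
  assumes \<Sigma>: "iqa_complex \<Sigma>" and f: "f \<in> trat"
  shows "rat_fun_on \<Sigma> (\<lambda>x. if x \<in> support \<Sigma> then f x else 0)" (is "rat_fun_on _ ?f")
  unfolding rat_fun_on_def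
proof (intro conjI allI impI)
  obtain H where H: "finite H" "H \<subseteq> iqaff" "uminus ` H \<subseteq> H"
    and cells: "\<And>K. K \<in> arrangement H \<Longrightarrow> \<exists>l\<in>iqaff. \<forall>u\<in>halfsp K. f u = aff l u"
    using trat_affine_on_cells[OF f] by metis
  let ?S' = "{P \<inter> halfsp K | P K. P \<in> \<Sigma> \<and> K \<in> arrangement H}"
  show "\<exists>\<Sigma>'. refinement \<Sigma>' \<Sigma> \<and> (\<forall>C\<in>\<Sigma>'. \<exists>m \<gamma>. \<forall>x\<in>C. ?f x = iqa m \<gamma> x)"
  proof (intro exI[of _ ?S'] conjI ballI)
    show "refinement ?S' \<Sigma>" by (rule refinement_arrangement[OF \<Sigma> H])
  next
    fix C assume "C \<in> ?S'"
    then obtain P K where C: "C = P \<inter> halfsp K" "P \<in> \<Sigma>" "K \<in> arrangement H" by blast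
    obtain l where l: "l \<in> iqaff" "\<forall>u\<in>halfsp K. f u = aff l u"
      using cells[OF C(3)] by blast
    then obtain m \<gamma> where "l = iqv m \<gamma>" by (auto simp: iqaff_def)
    then have "\<forall>u\<in>halfsp K. f u = iqa m \<gamma> u" using l(2) by (simp add: iqa_eq_aff)
    then show "\<exists>m \<gamma>. \<forall>x\<in>C. ?f x = iqa m \<gamma> x"
      using C by (intro exI[of _ m] exI[of _ \<gamma>]) (auto simp: support_def)
  qed
next
  fix p p' w s s'
  assume hl: "half_line_in p w (support \<Sigma>)" "half_line_in p' w (support \<Sigma>)"
    and s: "slope_at_infinity ?f p w s" "slope_at_infinity ?f p' w s'"
  obtain B where B: "\<And>x y. \<bar>f x - f y\<bar> \<le> B * norm (x - y)"
    using trat_lipschitz[OF f] by blast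
  show "s = s'"
  proof (rule slope_at_infinity_eqI[OF s])
    fix t :: real assume "0 \<le> t"
    then show "\<bar>?f (p + t *\<^sub>R w) - ?f (p' + t *\<^sub>R w)\<bar> \<le> B * norm (p - p')"
      using hl B[of "p + t *\<^sub>R w" "p' + t *\<^sub>R w"] by (simp add: half_line_in_def)
  qed
qed

lemma rat_fun_on_extends:
  assumes "rat_fun_on \<Sigma> f"
  shows "\<exists>F\<in>trat. \<forall>x\<in>support \<Sigma>. F x = f x"
proof -
  obtain \<Sigma>' where ref: "refinement \<Sigma>' \<Sigma>"
    and f_aff: "\<And>C. C \<in> \<Sigma>' \<Longrightarrow> \<exists>m \<gamma>. \<forall>x\<in>C. f x = iqa m \<gamma> x"
    and slopes: "\<And>p p' w s s'. half_line_in p w (support \<Sigma>) \<Longrightarrow> half_line_in p' w (support \<Sigma>)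
        \<Longrightarrow> slope_at_infinity f p w s \<Longrightarrow> slope_at_infinity f p' w s' \<Longrightarrow> s = s'"
    using assms unfolding rat_fun_on_def by metis
  have supp: "support \<Sigma> = \<Union>\<Sigma>'" using ref by (simp add: refinement_def support_def)
  \<comment> \<open>Every cell must supply a base point for half-lines, so the empty cell is
    dropped.\<close>
  define \<C> where "\<C> = {C \<in> \<Sigma>'. C \<noteq> {}}"
  have fin: "finite \<C>" using ref by (simp add: \<C>_def refinement_def iqa_complex_def)
  have supp\<C>: "support \<Sigma> = \<Union>\<C>" by (auto simp: supp \<C>_def)
  have "\<exists>L. finite L \<and> L \<subseteq> iqaff \<and> C = halfsp L" if "C \<in> \<C>" for C
    using that ref by (simp add: \<C>_def refinement_def iqa_complex_def iqa_polyhedron_iff)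
  then obtain L where L: "\<And>C. C \<in> \<C> \<Longrightarrow> finite (L C)" "\<And>C. C \<in> \<C> \<Longrightarrow> L C \<subseteq> iqaff"
    "\<And>C. C \<in> \<C> \<Longrightarrow> C = halfsp (L C)" by metis
  have "\<exists>l\<in>iqaff. \<forall>x\<in>C. f x = aff l x" if "C \<in> \<C>" for C
    using f_aff[of C] that by (auto simp: \<C>_def iqa_eq_aff)
  then obtain l where l: "\<And>C. C \<in> \<C> \<Longrightarrow> l C \<in> iqaff" "\<And>C x. C \<in> \<C> \<Longrightarrow> x \<in> C \<Longrightarrow> f x = aff (l C) x"
    by metis
  have slope: "half_line_in p r (support \<Sigma>) \<and> slope_at_infinity f p r (fst (l C) \<bullet> r)"
    if C: "C \<in> \<C>" "p \<in> C" and r: "r \<noteq> 0" "\<And>h. h \<in> L C \<Longrightarrow> 0 \<le> fst h \<bullet> r" for C p r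
  proof -
    have "p + t *\<^sub>R r \<in> C" if "0 \<le> t" for t
      using halfsp_ray[of p "L C" r t] C r(2) L(3)[OF C(1)] that by simp
    then show ?thesis
      using C r(1) by (auto simp: half_line_in_def supp\<C> l(2)[OF C(1)] intro!: slope_at_infinity_aff)
  qed
  have pair: "\<exists>k::nat. \<forall>u\<in>C. aff (l C - l D) u \<le> k * penalty (L D) u"
    if C: "C \<in> \<C>" and D: "D \<in> \<C>" for C D
  proof -
    have "\<exists>k::nat. \<forall>u\<in>halfsp (L C). aff (l C - l D) u \<le> k * penalty (L D) u"
    proof (rule aff_le_penalty[OF L(1)[OF C] L(1)[OF D]])
      fix u assume "u \<in> halfsp (L C)" "u \<in> halfsp (L D)"
      then have "u \<in> C" "u \<in> D" using L(3) C D by auto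
      then show "aff (l C - l D) u \<le> 0"
        using l(2)[OF C, of u] l(2)[OF D, of u] by (simp add: aff_diff)
    next
      fix r assume r: "\<And>h. h \<in> L C \<union> L D \<Longrightarrow> 0 \<le> fst h \<bullet> r"
      \<comment> \<open>A common recession direction starts parallel half-lines in \<open>C\<close>
        and \<open>D\<close>, even when the cells are disjoint; the slope condition on
        \<open>f\<close> then equates the gradients along \<open>r\<close>.\<close>
      obtain p p' where p: "p \<in> C" "p' \<in> D" using C D by (auto simp: \<C>_def)
      have "fst (l C) \<bullet> r = fst (l D) \<bullet> r"
      proof (cases "r = 0")
        case False
        then show ?thesis
          using slopes slope[OF C p(1) False] slope[OF D p(2) False] r by blast
      qed simp
      then show "fst (l C - l D) \<bullet> r \<le> 0" by (simp add: inner_diff_left)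
    qed
    then show ?thesis using L(3)[OF C] by simp
  qed
  \<comment> \<open>The factor may depend on \<open>D\<close> but not on \<open>C\<close>, so that
    one function \<open>G D\<close> dominates \<open>f\<close> on all cells.\<close>
  have "\<exists>k::nat. \<forall>C\<in>\<C>. \<forall>u\<in>C. aff (l C - l D) u \<le> k * penalty (L D) u" if "D \<in> \<C>" for D
    using uniform_factor[OF fin, of "penalty (L D)" "\<lambda>C. C" "\<lambda>C. aff (l C - l D)"] pair that
    by (simp add: penalty_nonneg)
  then obtain k where k: "\<And>C D u. C \<in> \<C> \<Longrightarrow> D \<in> \<C> \<Longrightarrow> u \<in> C \<Longrightarrow>
      aff (l C - l D) u \<le> real (k D) * penalty (L D) u" by metis
  define G where "G D x = aff (l D) x + real (k D) * penalty (L D) x" for D x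
  have G: "G D \<in> trat" if "D \<in> \<C>" for D
    unfolding G_def using that L(2) l(1)
    by (intro trat_add trat_of_nat_mult trat_penalty) (auto intro: trat_aff)
  show ?thesis
  proof (cases "\<C> = {}")
    case True
    then show ?thesis using trat_0 supp\<C> by auto
  next
    case False
    show ?thesis
    proof (intro bexI ballI)
      show "(\<lambda>x. MIN D\<in>\<C>. G D x) \<in> trat"
        using fin False G by (rule trat_Min)
      fix x assume "x \<in> support \<Sigma>"
      then obtain C where C: "C \<in> \<C>" "x \<in> C" using supp\<C> by blast
      have "penalty (L C) x = 0" using penalty_eq_0[of x "L C"] L(3)[OF C(1)] C(2) by simp
      then have "f x = G C x" using l(2)[OF C] by (simp add: G_def)
      moreover have "f x \<le> G D x" if "D \<in> \<C>" for D
        using k[OF C(1) that C(2)] l(2)[OF C] by (simp add: G_def aff_diff)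
      ultimately show "(MIN D\<in>\<C>. G D x) = f x"
        using fin C by (intro Min_eqI) auto
    qed
  qed
qed

section \<open>The kernel of restriction\<close>

text \<open>Lipschitz functions grow at most linearly. The sum of absolute coordinates replaces the
  Euclidean norm because it is itself tropical rational; the added \<open>1\<close> absorbs
  \<open>f 0\<close>.\<close>

lemma trat_le_l1:
  assumes "f \<in> trat"
  shows "\<exists>k::nat. \<forall>x. f x \<le> k * (1 + (\<Sum>i\<in>UNIV. \<bar>x $ i\<bar>))"
proof -
  obtain B where B: "B \<ge> 0" "\<And>x y. \<bar>f x - f y\<bar> \<le> B * norm (x - y)"
    using trat_lipschitz[OF assms] by blast
  define k where "k = nat \<lceil>\<bar>f 0\<bar> + B\<rceil>"
  have "f x \<le> k * (1 + (\<Sum>i\<in>UNIV. \<bar>x $ i\<bar>))" for x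
  proof -
    let ?n = "\<Sum>i\<in>UNIV. \<bar>x $ i\<bar>"
    have n: "0 \<le> ?n" by (simp add: sum_nonneg)
    have "f x \<le> \<bar>f 0\<bar> + B * norm x" using B(2)[of x 0] by simp
    also have "\<dots> \<le> \<bar>f 0\<bar> + B * ?n"
      using B(1) norm_le_l1_cart[of x] by (simp add: mult_left_mono)
    also have "\<dots> \<le> (\<bar>f 0\<bar> + B) * (1 + ?n)"
      using B(1) n by (simp add: algebra_simps)
    also have "\<dots> \<le> k * (1 + ?n)"
      using n unfolding k_def by (intro mult_right_mono) linarith+
    finally show ?thesis .
  qed
  then show ?thesis by blast
qed

lemma trat_l1: "(\<lambda>x::real^'n. 1 + (\<Sum>i\<in>UNIV. \<bar>x $ i\<bar>)) \<in> trat"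
proof -
  have coord: "(\<lambda>x::real^'n. x $ i) \<in> trat" for i
  proof -
    have "aff (iqv (axis i 1) 0) x = x $ i" for x :: "real^'n"
      by (simp add: iqa_eq_aff[symmetric] iqa_def axis_def if_distrib[where f="\<lambda>t. of_int t * _"] cong: if_cong)
    then have "aff (iqv (axis i 1) 0) = (\<lambda>x. x $ i)" by blast
    then show ?thesis by (metis trat_aff iqv_in_iqaff)
  qed
  have "(\<lambda>x::real^'n. of_rat 1 + (\<Sum>i\<in>UNIV. max (x $ i) (- x $ i))) \<in> trat"
    by (intro trat_add trat_const trat_sum trat_max coord trat_uminus)
  moreover have "max a (- a) = \<bar>a\<bar>" for a :: real by simp
  ultimately show ?thesis by simp
qed

lemma kernel_bound:
  assumes \<Sigma>: "iqa_complex \<Sigma>"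
  shows "\<exists>h\<in>trat. (\<forall>x\<in>support \<Sigma>. h x = 0)
    \<and> (\<forall>f\<in>trat. (\<forall>x\<in>support \<Sigma>. f x = 0) \<longrightarrow> (\<exists>k::nat. \<forall>x. f x \<le> k * h x))"
proof -
  define \<P> where "\<P> = {P \<in> \<Sigma>. P \<noteq> {}}"
  have fin: "finite \<P>" using \<Sigma> by (simp add: \<P>_def iqa_complex_def)
  have supp: "support \<Sigma> = \<Union>\<P>" by (auto simp: support_def \<P>_def)
  have "\<exists>M. finite M \<and> M \<subseteq> iqaff \<and> P = halfsp M" if "P \<in> \<P>" for P
    using that \<Sigma> by (simp add: \<P>_def iqa_complex_def iqa_polyhedron_iff)
  then obtain M where M: "\<And>P. P \<in> \<P> \<Longrightarrow> finite (M P)" "\<And>P. P \<in> \<P> \<Longrightarrow> M P \<subseteq> iqaff"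
    "\<And>P. P \<in> \<P> \<Longrightarrow> P = halfsp (M P)" by metis
  show ?thesis
  proof (cases "\<P> = {}")
    case True
    \<comment> \<open>There are no half-lines in the support, so \<open>h\<close> must grow in every direction.\<close>
    then show ?thesis
      using trat_le_l1 by (intro bexI[OF _ trat_l1]) (auto simp: supp)
  next
    case False
    let ?h = "\<lambda>x. MIN P\<in>\<P>. penalty (M P) x"
    have "?h x = 0" if "x \<in> support \<Sigma>" for x
    proof -
      obtain P where P: "P \<in> \<P>" "x \<in> P" using \<open>x \<in> support \<Sigma>\<close> supp by blast
      then have "penalty (M P) x = 0" using M(3) by (intro penalty_eq_0) auto
      then show ?thesis
        using fin P(1) by (intro Min_eqI) (auto simp: penalty_nonneg image_iff intro!: bexI[of _ P])
    qed
    moreover have "\<exists>k::nat. \<forall>x. f x \<le> k * ?h x" if f: "f \<in> trat" and f0: "\<forall>x\<in>support \<Sigma>. f x = 0" for f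
    proof -
      obtain H where H: "finite H" "uminus ` H \<subseteq> H"
        and cells: "\<And>K. K \<in> arrangement H \<Longrightarrow> \<exists>l\<in>iqaff. \<forall>u\<in>halfsp K. f u = aff l u"
        using trat_affine_on_cells[OF f] by metis
      obtain B where B: "\<And>x y. \<bar>f x - f y\<bar> \<le> B * norm (x - y)"
        using trat_lipschitz[OF f] by blast
      have cell: "\<exists>k::nat. \<forall>u\<in>halfsp K. f u \<le> k * penalty (M P) u"
        if P: "P \<in> \<P>" and K: "K \<in> arrangement H" for P K
      proof (cases "halfsp K = {}")
        case False
        then obtain a where a: "a \<in> halfsp K" by blast
        obtain p where p: "p \<in> P" using P by (auto simp: \<P>_def)
        have f0P: "f u = 0" if "u \<in> halfsp (M P)" for u
          using that f0 P M(3)[OF P] supp by auto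
        obtain l where l: "\<And>u. u \<in> halfsp K \<Longrightarrow> f u = aff l u" using cells[OF K] by blast
        have "\<exists>k::nat. \<forall>u\<in>halfsp K. aff l u \<le> k * penalty (M P) u"
        proof (rule aff_le_penalty[OF _ M(1)[OF P]])
          show "finite K" using K H(1) finite_subset by (auto simp: arrangement_def)
        next
          fix u assume "u \<in> halfsp K" "u \<in> halfsp (M P)"
          then show "aff l u \<le> 0" using l f0P by force
        next
          fix r assume r: "\<And>h. h \<in> K \<union> M P \<Longrightarrow> 0 \<le> fst h \<bullet> r"
          \<comment> \<open>Along the parallel ray from \<open>p\<close> inside \<open>P\<close> the
            function vanishes, so the Lipschitz bound keeps it bounded along the ray from
            \<open>a\<close>, and its slope there is zero.\<close>
          have bd: "\<bar>aff l (a + t *\<^sub>R r)\<bar> \<le> B * norm (a - p)" if t: "0 \<le> t" for t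
          proof -
            have "a + t *\<^sub>R r \<in> halfsp K" using a r t by (intro halfsp_ray) auto
            moreover have "p + t *\<^sub>R r \<in> halfsp (M P)"
              using p r t M(3)[OF P] by (intro halfsp_ray) auto
            ultimately show ?thesis
              using B[of "a + t *\<^sub>R r" "p + t *\<^sub>R r"] by (simp add: f0P l)
          qed
          have "fst l \<bullet> r = 0"
          proof (rule bounded_linear_growth_0)
            fix t :: real assume "0 < t"
            then show "(fst l \<bullet> r) * t + aff l a \<le> B * norm (a - p)"
              "- (B * norm (a - p)) \<le> (fst l \<bullet> r) * t + aff l a"
              using bd[of t] by (auto simp: aff_ray algebra_simps abs_le_iff)
          qed
          then show "fst l \<bullet> r \<le> 0" by simp
        qed
        then show ?thesis using l by auto
      qed auto
      have "\<exists>k::nat. \<forall>u\<in>UNIV. f u \<le> k * penalty (M P) u" if P: "P \<in> \<P>" for P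
      proof -
        have "\<exists>k::nat. \<forall>K\<in>arrangement H. \<forall>u\<in>halfsp K. f u \<le> k * penalty (M P) u"
          by (rule uniform_factor[OF finite_arrangement[OF H(1)] penalty_nonneg cell[OF P]])
        then show ?thesis using arrangement_cover[OF H(2)] by blast
      qed
      then obtain k where k: "\<And>P u. P \<in> \<P> \<Longrightarrow> f u \<le> real (k P) * penalty (M P) u" by (metis UNIV_I)
      \<comment> \<open>The estimate holds for every \<open>P\<close>, in particular for the one
        whose penalty attains the minimum at \<open>u\<close>.\<close>
      have "f u \<le> real (\<Sum>P\<in>\<P>. k P) * ?h u" for u
      proof -
        have "?h u \<in> (\<lambda>P. penalty (M P) u) ` \<P>" using fin False by (intro Min_in) auto
        then obtain P where P: "P \<in> \<P>" "?h u = penalty (M P) u" by blast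
        have "f u \<le> real (k P) * penalty (M P) u" using k[OF P(1)] .
        also have "\<dots> \<le> real (\<Sum>P\<in>\<P>. k P) * penalty (M P) u"
          using fin P(1) by (intro mult_right_mono of_nat_mono member_le_sum penalty_nonneg) auto
        finally show ?thesis using P(2) by simp
      qed
      then show ?thesis by blast
    qed
    moreover have "?h \<in> trat" using fin False M(2) by (intro trat_Min trat_penalty) auto
    ultimately show ?thesis by (intro bexI[of _ ?h]) simp_all
  qed
qed

section \<open>Congruences and the generating pair\<close>

lemma tadd_RatRn: "F \<in> RatRn \<Longrightarrow> G \<in> RatRn \<Longrightarrow> tadd F G \<in> RatRn"
  by (auto simp: RatRn_eq trat_min)

lemma tmul_RatRn: "F \<in> RatRn \<Longrightarrow> G \<in> RatRn \<Longrightarrow> tmul F G \<in> RatRn"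
  by (auto simp: RatRn_eq trat_add)

lemma restr_tadd: "restr S (tadd F G) = tadd (restr S F) (restr S G)"
  by (cases F; cases G) (auto simp: restr_def)

lemma restr_tmul: "restr S (tmul F G) = tmul (restr S F) (restr S G)"
  by (cases F; cases G) (auto simp: restr_def)

lemma restr_Some_eq_iff:
  "restr S (Some f) = restr S (Some g) \<longleftrightarrow> (\<forall>x\<in>S. f x = g x)"
  by (auto simp: restr_def fun_eq_iff)

lemma kernel_congruence:
  "congruence_on RatRn tadd tmul
     {(F, G). F \<in> RatRn \<and> G \<in> RatRn \<and> restr S F = restr S G}"
  unfolding congruence_on_def
proof (intro conjI)
  show "equiv RatRn {(F, G). F \<in> RatRn \<and> G \<in> RatRn \<and> restr S F = restr S G}"
    by (intro equivI) (auto simp: refl_on_def sym_def trans_def)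
qed (auto simp: tadd_RatRn tmul_RatRn restr_tadd restr_tmul)

text \<open>Tropical powers of the pair give \<open>0 \<sim> k * h\<close>; taking the minimum with
  \<open>u\<close> turns the left side into \<open>0\<close> and the right side into
  \<open>u\<close>.\<close>

lemma congruence_absorb:
  assumes R: "congruence_on RatRn tadd tmul R"
    and h: "(Some (\<lambda>x. 0), Some h) \<in> R"
    and u: "u \<in> trat" "\<And>x. 0 \<le> u x" "\<And>x. u x \<le> real k * h x"
  shows "(Some (\<lambda>x. 0), Some u) \<in> R"
proof -
  have refl: "(Some f, Some f) \<in> R" if "f \<in> trat" for f
    using R that unfolding congruence_on_def equiv_def refl_on_def RatRn_eq by blast
  have add: "(tadd a a', tadd b b') \<in> R" and mul: "(tmul a a', tmul b b') \<in> R"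
    if "(a, b) \<in> R" "(a', b') \<in> R" for a b a' b'
    using R that unfolding congruence_on_def by blast+
  have "(Some (\<lambda>x. 0), Some (\<lambda>x. real j * h x)) \<in> R" for j
  proof (induction j)
    case 0
    then show ?case using refl[OF trat_0] by simp
  next
    case (Suc j)
    then show ?case using mul[OF h Suc] by (simp add: distrib_right)
  qed
  from add[OF this[of k] refl[OF u(1)]] show ?thesis
    using u(2,3) by (simp add: min_absorb1 min_absorb2)
qed

text \<open>Both \<open>f + max (g - f) 0\<close> and \<open>g + max (f - g) 0\<close> equal
  \<open>max f g\<close>, so \<open>f\<close> and \<open>g\<close> are each congruent to it.\<close>

lemma congruence_of_nonneg_parts:
  assumes R: "congruence_on RatRn tadd tmul R"
    and fg: "f \<in> trat" "g \<in> trat"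
    and pos: "(Some (\<lambda>x. 0), Some (\<lambda>x. max (f x - g x) 0)) \<in> R"
    and neg: "(Some (\<lambda>x. 0), Some (\<lambda>x. max (g x - f x) 0)) \<in> R"
  shows "(Some f, Some g) \<in> R"
proof -
  have refl: "(Some f, Some f) \<in> R" if "f \<in> trat" for f
    using R that unfolding congruence_on_def equiv_def refl_on_def RatRn_eq by blast
  have mul: "(tmul a a', tmul b b') \<in> R" if "(a, b) \<in> R" "(a', b') \<in> R" for a b a' b'
    using R that unfolding congruence_on_def by blast
  have sym: "(b, a) \<in> R" if "(a, b) \<in> R" for a b
    using R that unfolding congruence_on_def equiv_def sym_def by blast
  have trans: "(a, c) \<in> R" if "(a, b) \<in> R" "(b, c) \<in> R" for a b c
    using R that unfolding congruence_on_def equiv_def trans_def by blast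
  have "(Some f, Some (\<lambda>x. max (f x) (g x))) \<in> R"
    using mul[OF refl[OF fg(1)] neg] by (simp add: max_add_distrib_right max.commute)
  moreover have "(Some g, Some (\<lambda>x. max (f x) (g x))) \<in> R"
    using mul[OF refl[OF fg(2)] pos] by (simp add: max_add_distrib_right max.commute)
  ultimately show ?thesis using sym trans by blast
qed

theorem theorem1p4:
  fixes \<Sigma> :: "(real^'n) set set"
  assumes "iqa_complex \<Sigma>"
  shows "restr (support \<Sigma>) ` RatRn = RatS \<Sigma>
         \<and> finitely_generated_congruence RatRn tadd tmul
           {(F, G). F \<in> RatRn \<and> G \<in> RatRn \<and> restr (support \<Sigma>) F = restr (support \<Sigma>) G}"
proof
  let ?S = "support \<Sigma>"
  show "restr ?S ` RatRn = RatS \<Sigma>"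
  proof (intro equalityI subsetI)
    fix F assume "F \<in> restr ?S ` RatRn"
    then show "F \<in> RatS \<Sigma>"
      using rat_fun_on_trat[OF assms] by (auto simp: RatRn_eq RatS_def restr_def)
  next
    fix F assume "F \<in> RatS \<Sigma>"
    then consider "F = None"
      | f where "F = Some f" "\<And>x. x \<notin> ?S \<Longrightarrow> f x = 0" "rat_fun_on \<Sigma> f"
      unfolding RatS_def by blast
    then show "F \<in> restr ?S ` RatRn"
    proof cases
      case 1
      then have "F = restr ?S None" by (simp add: restr_def)
      then show ?thesis by (auto simp: RatRn_eq)
    next
      case 2
      obtain G where G: "G \<in> trat" "\<forall>x\<in>?S. G x = f x"
        using rat_fun_on_extends[OF 2(3)] by blast
      then have "F = restr ?S (Some G)"
        using 2 by (auto simp: restr_def fun_eq_iff)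
      then show ?thesis using G(1) by (auto simp: RatRn_eq)
    qed
  qed
  let ?R = "{(F, G). F \<in> RatRn \<and> G \<in> RatRn \<and> restr ?S F = restr ?S G}"
  obtain h where h: "h \<in> trat" "\<forall>x\<in>?S. h x = 0"
    and bound: "\<And>f. f \<in> trat \<Longrightarrow> \<forall>x\<in>?S. f x = 0 \<Longrightarrow> \<exists>k::nat. \<forall>x. f x \<le> k * h x"
    using kernel_bound[OF assms] by blast
  \<comment> \<open>A single pair generates the kernel: the zero function, which is the tropical
    unit, against the dominating function \<open>h\<close>.\<close>
  let ?P = "{(Some (\<lambda>x::real^'n. 0), Some h)}"
  have P: "?P \<subseteq> RatRn \<times> RatRn" using h(1) by (simp add: RatRn_eq trat_0)
  have "?P \<subseteq> ?R" using h P by (simp add: restr_Some_eq_iff)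
  then have "generated_congruence RatRn tadd tmul ?P \<subseteq> ?R"
    unfolding generated_congruence_def using kernel_congruence[of ?S] by blast
  moreover have "(F, G) \<in> R"
    if FG: "(F, G) \<in> ?R" and R: "congruence_on RatRn tadd tmul R" and PR: "?P \<subseteq> R" for F G R
  proof -
    have hR: "(Some (\<lambda>x. 0), Some h) \<in> R" using PR by simp
    \<comment> \<open>Stated for arbitrary \<open>f\<close> and \<open>g\<close> so that swapping
      them also covers the negative part of the difference.\<close>
    have pos: "(Some (\<lambda>x. 0), Some (\<lambda>x. max (f x - g x) 0)) \<in> R"
      if "f \<in> trat" "g \<in> trat" "\<forall>x\<in>?S. f x = g x" for f g
    proof -
      have t: "(\<lambda>x. max (f x - g x) 0) \<in> trat"
        using that by (intro trat_max trat_diff trat_0)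
      have "\<forall>x\<in>?S. max (f x - g x) 0 = 0" using that(3) by simp
      then obtain k :: nat where "\<forall>x. max (f x - g x) 0 \<le> k * h x"
        using bound[OF t] by blast
      then show ?thesis by (intro congruence_absorb[OF R hR t, of k]) simp_all
    qed
    show ?thesis
    proof (cases F)
      case None
      then have "G = None" "F \<in> RatRn" using FG by (auto simp: restr_def)
      then show ?thesis
        using R None unfolding congruence_on_def equiv_def refl_on_def by blast
    next
      case (Some f)
      then obtain g where G: "G = Some g" using FG by (cases G) (auto simp: restr_def)
      then have fg: "f \<in> trat" "g \<in> trat" "\<forall>x\<in>?S. f x = g x"
        using FG Some by (auto simp: RatRn_eq restr_Some_eq_iff)
      then show ?thesis
        using congruence_of_nonneg_parts[OF R fg(1,2) pos[OF fg] pos[OF fg(2,1)]]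
        by (simp add: Some G)
    qed
  qed
  then have "?R \<subseteq> generated_congruence RatRn tadd tmul ?P"
    unfolding generated_congruence_def by blast
  ultimately show "finitely_generated_congruence RatRn tadd tmul ?R"
    unfolding finitely_generated_congruence_def using P by (intro exI[of _ ?P]) auto
qed

end
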